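(* Let $K$ be a fixed set of $k$ positive integers. Then for every integer $n\geqslant 1$ and for any sequence of sets $L_1,\ldots,L_n$, each of size at least $2k+10\sqrt{k}$, there exists a sequence $S=s_1\ldots s_n$ with $s_i\in L_i$ for all $i=1,\ldots,n$ such that for every $d\in K$ and every starting index $i\in\{1,\ldots,n\}$, the subsequence $s_i s_{i+d} s_{i+2d}\ldots s_{i+td}$ (where $t$ is the largest integer with $i+td\leqslant n$) is nonrepetitive.
   Context: A finite sequence $x_1x_2\ldots x_m$ contains a repetition of size $h\geqslant 1$ if it has a block of consecutive terms of the form $y_1\ldots y_h y_1\ldots y_h$ (two identical adjacent blocks of length $h$); it is nonrepetitive if it contains no repetition of any size $h\geqslant 1$. *)

theory Defs
  imports Complex_Main
begin

definition contains_repetition :: "nat \<Rightarrow> 'a list \<Rightarrow> bool" where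
  "contains_repetition h xs \<longleftrightarrow> (\<exists>us ys vs. length ys = h \<and> xs = us @ ys @ ys @ vs)"

definition nonrepetitive :: "'a list \<Rightarrow> bool" where
  "nonrepetitive xs \<longleftrightarrow> (\<forall>h\<ge>1. \<not> contains_repetition h xs)"

(* For 1 <= i <= n and d >= 1 this is the word s_i s_{i+d} ... s_{i+td}, including
   the last term s_{i+td}; for d = 0 or i > n the GREATEST is unspecified. *)
definition ap_subsequence :: "(nat \<Rightarrow> 'a) \<Rightarrow> nat \<Rightarrow> nat \<Rightarrow> nat \<Rightarrow> 'a list" where
  "ap_subsequence s n i d = map (\<lambda>j. s (i + j * d)) [0..<Suc (GREATEST t. i + t * d \<le> n)]"

lemma ap_subsequence_eq:
  assumes "d > 0" and "i \<le> n"
  shows "ap_subsequence s n i d = map (\<lambda>j. s (i + j * d)) [0..<Suc ((n - i) div d)]"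
proof -
  have *: "i + t * d \<le> n \<longleftrightarrow> t \<le> (n - i) div d" for t
    using assms by (auto simp: less_eq_div_iff_mult_less_eq)
  have "(GREATEST t. i + t * d \<le> n) = (n - i) div d"
    unfolding * by (rule Greatest_equality) auto
  then show ?thesis
    by (simp add: ap_subsequence_def)
qed

end

theory Submission
  imports Defs "HOL-Library.FuncSet"
begin

text \<open>
  The proof is Rosenfeld's counting argument.  For a finite set \<open>V\<close> of positions let \<open>N V\<close> be the
  number of colorings of \<open>V\<close> from the lists without a repetition along a progression inside \<open>V\<close>.
  Put \<open>\<beta> = 1 + 2 * sqrt k\<close>.  By induction on \<open>V\<close> one shows
  \<open>N (insert v V) \<ge> \<beta> * N V\<close>: of the \<open>card (L v) * N V\<close> extensions, those with a repetition of size
  \<open>h\<close> and difference \<open>d\<close> having \<open>v\<close> as its \<open>j\<close>-th term, \<open>j < 2 * h\<close>, are determined by their values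
  outside the half of the repetition that contains \<open>v\<close>, so by the induction hypothesis there are at
  most \<open>N V / \<beta> ^ (h - 1)\<close> of them.  Summing over \<open>d\<close>, \<open>h\<close> and \<open>j\<close> excludes at most
  \<open>2 * k / (1 - 1 / \<beta>)\<^sup>2 * N V\<close> extensions.  It is essential that \<open>V\<close> is arbitrary and not an
  initial segment, since half a progression is removed from it.
\<close>

section \<open>Colorings without repetitions, and their restriction to fewer positions\<close>

definition progression :: "nat \<Rightarrow> nat \<Rightarrow> nat \<Rightarrow> nat set" where
  "progression d i m = (\<lambda>j. i + j * d) ` {..<m}"

definition square_at :: "(nat \<Rightarrow> 'a) \<Rightarrow> nat \<Rightarrow> nat \<Rightarrow> nat \<Rightarrow> bool" where
  "square_at c d h i \<longleftrightarrow> (\<forall>j<h. c (i + j * d) = c (i + (h + j) * d))"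

text \<open>\<open>PiE\<close> fixes the values outside \<open>V\<close>, so that functions agreeing
  on \<open>V\<close> are counted once. Only progressions with all their terms in \<open>V\<close>
  matter, which gives sense to sets \<open>V\<close> with gaps.\<close>

definition square_free_colorings :: "nat set \<Rightarrow> (nat \<Rightarrow> 'a set) \<Rightarrow> nat set \<Rightarrow> (nat \<Rightarrow> 'a) set" where
  "square_free_colorings K L V = {c \<in> PiE V L.
     \<forall>d\<in>K. \<forall>h\<ge>1. \<forall>i. progression d i (2 * h) \<subseteq> V \<longrightarrow> \<not> square_at c d h i}"

lemma card_progression: "d > 0 \<Longrightarrow> card (progression d i m) = m"
  by (simp add: progression_def card_image inj_on_def)

lemma progression_memI: "j < m \<Longrightarrow> i + j * d \<in> progression d i m"
  by (auto simp: progression_def)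

lemma square_at_restrict:
  assumes "progression d i (2 * h) \<subseteq> V"
  shows "square_at (restrict c V) d h i \<longleftrightarrow> square_at c d h i"
proof -
  have "i + j * d \<in> V" "i + (h + j) * d \<in> V" if "j < h" for j
    using assms that progression_memI[of j "2 * h"] progression_memI[of "h + j" "2 * h"] by auto
  then show ?thesis
    by (simp add: square_at_def)
qed

lemma finite_square_free_colorings:
  assumes "finite V" "\<And>i. i \<in> V \<Longrightarrow> finite (L i)"
  shows "finite (square_free_colorings K L V)"
  using finite_PiE[of V L] assms by (simp add: square_free_colorings_def)

lemma restrict_square_free_colorings:
  assumes "c \<in> square_free_colorings K L W" "V \<subseteq> W"
  shows "restrict c V \<in> square_free_colorings K L V"
  unfolding square_free_colorings_def mem_Collect_eq
proof (intro conjI ballI allI impI)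
  show "restrict c V \<in> PiE V L"
    using assms by (auto simp: square_free_colorings_def)
next
  fix d h :: nat and i
  assume "d \<in> K" "1 \<le> h" "progression d i (2 * h) \<subseteq> V"
  then show "\<not> square_at (restrict c V) d h i"
    using assms by (auto simp: square_free_colorings_def square_at_restrict)
qed

text \<open>The deleted half can be copied back from the other half. The offset \<open>a\<close>
  selects which half is deleted: 0 the first, \<open>h\<close> the second.\<close>

lemma inj_on_restrict_squares:
  fixes h :: nat
  assumes "d > 0" "progression d i (2 * h) \<subseteq> W" "a \<in> {0, h}"
  shows "inj_on (\<lambda>c. restrict c (W - progression d (i + a * d) h))
           {c \<in> PiE W L. square_at c d h i}"
proof (rule inj_onI, rule ext)
  let ?H = "progression d (i + a * d) h"
  fix c c' x
  assume c: "c \<in> {c \<in> PiE W L. square_at c d h i}" and c': "c' \<in> {c \<in> PiE W L. square_at c d h i}"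
    and eq: "restrict c (W - ?H) = restrict c' (W - ?H)"
  have outside: "c y = c' y" if "y \<in> W - ?H" for y
    using fun_cong[OF eq, of y] that by simp
  show "c x = c' x"
  proof (cases "x \<in> W")
    case False
    then show ?thesis using c c' by (auto simp: PiE_arb[of _ W])
  next
    case True
    show ?thesis
    proof (cases "x \<in> ?H")
      case False
      then show ?thesis using outside True by simp
    next
      case True
      then obtain t where t: "t < h" "x = i + a * d + t * d"
        by (auto simp: progression_def)
      \<comment> \<open>Since \<open>h - a\<close> is the offset of the half that is kept,
        \<open>y\<close> is the twin of \<open>x\<close> in that half.\<close>
      define y where "y = i + (h - a + t) * d"
      have "y \<in> W"
        using assms(2) t(1) progression_memI[of "h - a + t" "2 * h" i d] by (auto simp: y_def)
      moreover have "y \<notin> ?H"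
      proof
        assume "y \<in> ?H"
        then obtain u where "u < h" "(h - a + t) * d = (a + u) * d"
          by (auto simp: y_def progression_def algebra_simps)
        then show False using assms t(1) by auto
      qed
      ultimately have "c y = c' y" using outside by simp
      moreover have "c x = c y" "c' x = c' y"
        using c c' t assms(3) by (auto simp: square_at_def y_def algebra_simps)
      ultimately show ?thesis by simp
    qed
  qed
qed

section \<open>Counting colorings and their extensions\<close>

text \<open>The points of \<open>S\<close> are put back one at a time, each gaining a factor
  \<beta>. The growth \<open>step\<close> is assumed only from proper subsets of \<open>V\<close>,
  which is what a strong induction on \<open>V\<close> can supply.\<close>

lemma card_square_free_colorings_Diff:
  fixes \<beta> :: real
  assumes "finite V" "S \<subseteq> V" "\<beta> > 0"
    and step: "\<And>U v. U \<subset> V \<Longrightarrow> v \<in> V - U \<Longrightarrow>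
      \<beta> * card (square_free_colorings K L U) \<le> card (square_free_colorings K L (insert v U))"
  shows "\<beta> ^ card S * card (square_free_colorings K L (V - S)) \<le> card (square_free_colorings K L V)"
proof -
  have "finite S" using assms finite_subset by blast
  then show ?thesis using \<open>S \<subseteq> V\<close>
  proof (induction S rule: finite_induct)
    case empty
    then show ?case by simp
  next
    case (insert x S)
    have "insert x (V - insert x S) = V - S" using insert by auto
    then have "\<beta> * card (square_free_colorings K L (V - insert x S))
        \<le> card (square_free_colorings K L (V - S))"
      using step[of "V - insert x S" x] insert by auto
    then have "\<beta> ^ card S * (\<beta> * card (square_free_colorings K L (V - insert x S)))
        \<le> \<beta> ^ card S * card (square_free_colorings K L (V - S))"
      using \<open>\<beta> > 0\<close> by (intro mult_left_mono) auto
    then show ?case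
      using insert by (simp add: mult_ac)
  qed
qed

text \<open>Repetitions through \<open>v\<close> are still allowed here, so the color of
  \<open>v\<close> is chosen independently of the coloring of \<open>V\<close>.\<close>

lemma card_extensions:
  assumes "v \<notin> V"
  shows "card {c \<in> PiE (insert v V) L. restrict c V \<in> square_free_colorings K L V}
       = card (L v) * card (square_free_colorings K L V)"
proof -
  have "bij_betw (\<lambda>(y, g). g(v := y)) (L v \<times> square_free_colorings K L V)
      {c \<in> PiE (insert v V) L. restrict c V \<in> square_free_colorings K L V}"
  proof (rule bij_betw_byWitness[where f' = "\<lambda>c. (c v, restrict c V)"])
    have PiE: "g \<in> PiE V L" if "g \<in> square_free_colorings K L V" for g
      using that by (simp add: square_free_colorings_def)
    have upd: "restrict (g(v := y)) V = g" if "g \<in> square_free_colorings K L V" for g y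
    proof
      show "restrict (g(v := y)) V x = g x" for x
        using PiE_arb[OF PiE[OF that], of x] assms by (auto simp: restrict_def)
    qed
    show "\<forall>p\<in>L v \<times> square_free_colorings K L V.
        (\<lambda>c. (c v, restrict c V)) ((\<lambda>(y, g). g(v := y)) p) = p"
      using upd by auto
    show "\<forall>c\<in>{c \<in> PiE (insert v V) L. restrict c V \<in> square_free_colorings K L V}.
        (\<lambda>(y, g). g(v := y)) (c v, restrict c V) = c"
    proof (clarsimp, rule ext)
      fix c x assume "c \<in> PiE (insert v V) L"
      from PiE_arb[OF this, of x] show "((restrict c V)(v := c v)) x = c x"
        by (auto simp: restrict_def)
    qed
    show "(\<lambda>(y, g). g(v := y)) ` (L v \<times> square_free_colorings K L V)
        \<subseteq> {c \<in> PiE (insert v V) L. restrict c V \<in> square_free_colorings K L V}"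
      using upd PiE by (auto intro!: PiE_fun_upd)
    show "(\<lambda>c. (c v, restrict c V)) ` {c \<in> PiE (insert v V) L. restrict c V \<in> square_free_colorings K L V}
        \<subseteq> L v \<times> square_free_colorings K L V"
      by auto
  qed
  then show ?thesis
    by (simp add: bij_betw_same_card[symmetric] card_cartesian_product)
qed

lemma card_extensions_with_square:
  fixes \<beta> :: real
  assumes "finite V" "v \<notin> V" "d > 0" "\<beta> > 0" "j < 2 * Suc m"
    and fin: "\<And>i. i \<in> insert v V \<Longrightarrow> finite (L i)"
    and sub: "progression d i (2 * Suc m) \<subseteq> insert v V" and v: "v = i + j * d"
    and step: "\<And>U v. U \<subset> V \<Longrightarrow> v \<in> V - U \<Longrightarrow>
      \<beta> * card (square_free_colorings K L U) \<le> card (square_free_colorings K L (insert v U))"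
  shows "card {c \<in> PiE (insert v V) L. restrict c V \<in> square_free_colorings K L V \<and> square_at c d (Suc m) i}
       \<le> (1 / \<beta>) ^ m * card (square_free_colorings K L V)"
    (is "real (card ?B) \<le> _")
proof -
  let ?W = "insert v V"
  \<comment> \<open>The offset of the half that contains \<open>v\<close>.\<close>
  define a where "a = (if j < Suc m then 0 else Suc m)"
  define H where "H = progression d (i + a * d) (Suc m)"
  have "v = (i + a * d) + (j - a) * d" "j - a < Suc m"
    using v \<open>j < 2 * Suc m\<close> by (auto simp: a_def simp flip: add_mult_distrib)
  then have "v \<in> H"
    unfolding H_def by (metis progression_memI)
  have "H \<subseteq> ?W"
  proof
    fix x assume "x \<in> H"
    then obtain t where t: "t < Suc m" "x = i + (a + t) * d"
      by (auto simp: H_def progression_def algebra_simps)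
    then have "a + t < 2 * Suc m" by (auto simp: a_def)
    then show "x \<in> ?W" using sub progression_memI t(2) by blast
  qed
  \<comment> \<open>As \<open>v\<close> lies in \<open>H\<close> but not in \<open>V\<close>, only
    \<open>m\<close> of the \<open>Suc m\<close> points of \<open>H\<close> are removed from
    \<open>V\<close>; hence the exponent \<open>m\<close>.\<close>
  have W_H: "?W - H = V - (H - {v})" using \<open>v \<in> H\<close> \<open>v \<notin> V\<close> by auto
  have "card H = Suc m" using \<open>d > 0\<close> by (simp add: H_def card_progression)
  then have card_H: "card (H - {v}) = m" using \<open>v \<in> H\<close> by simp
  have "inj_on (\<lambda>c. restrict c (?W - H)) {c \<in> PiE ?W L. square_at c d (Suc m) i}"
    unfolding H_def by (rule inj_on_restrict_squares) (use \<open>d > 0\<close> sub in \<open>auto simp: a_def\<close>)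
  then have "inj_on (\<lambda>c. restrict c (?W - H)) ?B"
    by (rule inj_on_subset) auto
  moreover have "(\<lambda>c. restrict c (?W - H)) ` ?B \<subseteq> square_free_colorings K L (?W - H)"
  proof (clarify)
    fix c assume "restrict c V \<in> square_free_colorings K L V"
    then have "restrict (restrict c V) (?W - H) \<in> square_free_colorings K L (?W - H)"
      by (rule restrict_square_free_colorings) (use W_H in auto)
    moreover have "V \<inter> (?W - H) = ?W - H" using W_H by auto
    ultimately show "restrict c (?W - H) \<in> square_free_colorings K L (?W - H)"
      by simp
  qed
  moreover have "finite (square_free_colorings K L (?W - H))"
    using assms(1) fin by (intro finite_square_free_colorings) auto
  ultimately have "card ?B \<le> card (square_free_colorings K L (V - (H - {v})))"
    unfolding W_H by (rule card_inj_on_le)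
  moreover have "\<beta> ^ m * card (square_free_colorings K L (V - (H - {v})))
      \<le> card (square_free_colorings K L V)"
    using card_square_free_colorings_Diff[of V "H - {v}" \<beta> K L] step assms(1,4) \<open>H \<subseteq> ?W\<close> card_H
    by auto
  ultimately have "\<beta> ^ m * card ?B \<le> card (square_free_colorings K L V)"
    using \<open>\<beta> > 0\<close> by (smt (verit) mult_left_mono of_nat_mono zero_le_power)
  then show ?thesis
    using \<open>\<beta> > 0\<close> by (simp add: field_simps power_divide)
qed

text \<open>The partial sums of the differentiated geometric series have nonnegative terms and stay
  below its value.\<close>

lemma sum_Suc_mult_power_le:
  fixes r :: real
  assumes "0 \<le> r" "r < 1"
  shows "(\<Sum>m<M. real (Suc m) * r ^ m) \<le> 1 / (1 - r)\<^sup>2"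
proof -
  have "(\<lambda>m. real (Suc m) * r ^ m) sums (1 / (1 - r)\<^sup>2)"
    using geometric_deriv_sums[of r] assms by simp
  then show ?thesis
    using assms by (metis (no_types, lifting) sum_le_suminf sums_unique sums_summable finite_lessThan
        mult_nonneg_nonneg of_nat_0_le_iff zero_le_power)
qed

lemma square_free_colorings_insert:
  fixes \<beta> :: real
  assumes K: "finite K" "\<And>d. d \<in> K \<Longrightarrow> d > 0" and "\<beta> > 1"
    and V: "finite V" "v \<notin> V"
    and L: "\<And>i. i \<in> insert v V \<Longrightarrow> finite (L i)"
      "\<And>i. i \<in> insert v V \<Longrightarrow> \<beta> + 2 * card K / (1 - 1 / \<beta>)\<^sup>2 \<le> card (L i)"
  shows "\<beta> * card (square_free_colorings K L V) \<le> card (square_free_colorings K L (insert v V))"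
  using V L
proof (induction V arbitrary: v rule: finite_psubset_induct)
  case (psubset V)
  let ?W = "insert v V" and ?N = "real (card (square_free_colorings K L V))"
  define X where "X = {c \<in> PiE ?W L. restrict c V \<in> square_free_colorings K L V}"
  define M where "M = card ?W"
  \<comment> \<open>A triple consists of the difference, the size minus one, and the place of
    \<open>v\<close> among the \<open>2 * Suc m\<close> terms. Sizes below or equal to
    \<open>M\<close> suffice, because a progression inside \<open>?W\<close> has at most
    \<open>M\<close> terms.\<close>
  define I where "I = K \<times> (SIGMA m:{..<M}. {..<2 * Suc m})"
  \<comment> \<open>The condition \<open>j * d \<le> v\<close> keeps the truncated subtraction in
    the starting point \<open>v - j * d\<close> exact.\<close>
  define B where "B = (\<lambda>(d, m, j). {c \<in> X. j * d \<le> v \<and>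
    progression d (v - j * d) (2 * Suc m) \<subseteq> ?W \<and> square_at c d (Suc m) (v - j * d)})"
  have step: "\<beta> * card (square_free_colorings K L U) \<le> card (square_free_colorings K L (insert u U))"
    if "U \<subset> V" "u \<in> V - U" for U u
    using that psubset.prems by (intro psubset.IH) auto
  have "finite X"
    unfolding X_def using finite_PiE[of ?W L] psubset.hyps psubset.prems by auto
  have "finite I" using K by (simp add: I_def)
  have "X - square_free_colorings K L ?W \<subseteq> (\<Union>p\<in>I. B p)"
  proof
    fix c assume c: "c \<in> X - square_free_colorings K L ?W"
    then obtain d h i where dhi: "d \<in> K" "h \<ge> 1" "progression d i (2 * h) \<subseteq> ?W" "square_at c d h i"
      by (auto simp: X_def square_free_colorings_def)
    \<comment> \<open>The restriction of \<open>c\<close> to \<open>V\<close> is square-free, so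
      every repetition of \<open>c\<close> must pass through \<open>v\<close>.\<close>
    have "\<not> progression d i (2 * h) \<subseteq> V"
      using c dhi square_at_restrict[of d i h V c] by (auto simp: X_def square_free_colorings_def)
    then have "v \<in> progression d i (2 * h)" using dhi by auto
    then obtain j where j: "j < 2 * h" "v = i + j * d" by (auto simp: progression_def)
    have "2 * h \<le> M"
      unfolding M_def using card_mono[OF _ dhi(3)] card_progression[of d i "2 * h"] K dhi psubset.hyps
      by auto
    then have "(d, h - 1, j) \<in> I" using dhi j by (auto simp: I_def)
    moreover have "c \<in> B (d, h - 1, j)"
    proof -
      have "Suc (h - 1) = h" "v - j * d = i" "j * d \<le> v" using dhi j by auto
      then show ?thesis using c dhi by (simp only: B_def prod.case mem_Collect_eq) blast
    qed
    ultimately show "c \<in> (\<Union>p\<in>I. B p)" by blast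
  qed
  then have "X \<subseteq> square_free_colorings K L ?W \<union> (\<Union>p\<in>I. B p)" by blast
  moreover have fin_sf: "finite (square_free_colorings K L ?W)"
    using psubset by (intro finite_square_free_colorings) auto
  moreover have "finite (B p)" for p
    using \<open>finite X\<close> by (auto simp: B_def split: prod.split)
  ultimately have "card X \<le> card (square_free_colorings K L ?W \<union> (\<Union>p\<in>I. B p))"
    using \<open>finite I\<close> by (intro card_mono) auto
  also have "\<dots> \<le> card (square_free_colorings K L ?W) + card (\<Union>p\<in>I. B p)"
    by (rule card_Un_le)
  also have "card (\<Union>p\<in>I. B p) \<le> (\<Sum>p\<in>I. card (B p))"
    using \<open>finite I\<close> by (rule card_UN_le)
  finally have "real (card X) \<le> real (card (square_free_colorings K L ?W) + (\<Sum>p\<in>I. card (B p)))"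
    by (simp only: of_nat_le_iff)
  then have X_le: "real (card X) \<le> card (square_free_colorings K L ?W) + (\<Sum>p\<in>I. real (card (B p)))"
    by simp
  have B_le: "real (card (B (d, m, j))) \<le> (1 / \<beta>) ^ m * ?N" if "(d, m, j) \<in> I" for d m j
  proof (cases "j * d \<le> v \<and> progression d (v - j * d) (2 * Suc m) \<subseteq> ?W")
    case True
    then have "B (d, m, j) = {c \<in> PiE ?W L. restrict c V \<in> square_free_colorings K L V
        \<and> square_at c d (Suc m) (v - j * d)}"
      by (auto simp: B_def X_def)
    also have "real (card \<dots>) \<le> (1 / \<beta>) ^ m * ?N"
      by (rule card_extensions_with_square[where j = j])
        (use that True K \<open>\<beta> > 1\<close> psubset.hyps psubset.prems step in \<open>auto simp: I_def\<close>)
    finally show ?thesis .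
  next
    case False
    then have "B (d, m, j) = {}" by (auto simp: B_def)
    then show ?thesis using \<open>\<beta> > 1\<close> by simp
  qed
  have "(\<Sum>p\<in>I. real (card (B p))) \<le> (\<Sum>(d, m, j)\<in>I. (1 / \<beta>) ^ m * ?N)"
    using B_le by (intro sum_mono) auto
  also have "\<dots> = (\<Sum>d\<in>K. \<Sum>m<M. \<Sum>j<2 * Suc m. (1 / \<beta>) ^ m * ?N)"
    by (subst sum.Sigma) (simp_all add: I_def sum.cartesian_product del: sum_constant sum.lessThan_Suc)
  \<comment> \<open>The \<open>2 * Suc m\<close> possible places of \<open>v\<close> turn the
    geometric series into its derivative, up to the factor 2.\<close>
  also have "\<dots> = 2 * card K * ?N * (\<Sum>m<M. real (Suc m) * (1 / \<beta>) ^ m)"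
    by (simp add: sum_distrib_left mult_ac algebra_simps)
  also have "\<dots> \<le> 2 * card K * ?N * (1 / (1 - 1 / \<beta>)\<^sup>2)"
    using \<open>\<beta> > 1\<close> by (intro mult_left_mono sum_Suc_mult_power_le) auto
  finally have "(\<Sum>p\<in>I. real (card (B p))) \<le> 2 * card K / (1 - 1 / \<beta>)\<^sup>2 * ?N"
    by simp
  moreover have "real (card X) = card (L v) * ?N"
    using card_extensions[OF \<open>v \<notin> V\<close>, of L K] by (simp add: X_def)
  moreover have "(\<beta> + 2 * card K / (1 - 1 / \<beta>)\<^sup>2) * ?N \<le> card (L v) * ?N"
    using psubset.prems by (intro mult_right_mono) auto
  ultimately show ?case
    using X_le by (simp add: distrib_right)
qed

section \<open>From a positive count to the sequence\<close>

lemma square_free_colorings_nonempty: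
  fixes \<beta> :: real
  assumes K: "finite K" "\<And>d. d \<in> K \<Longrightarrow> d > 0" and "\<beta> > 1"
    and "finite V"
    and L: "\<And>i. i \<in> V \<Longrightarrow> finite (L i)"
      "\<And>i. i \<in> V \<Longrightarrow> \<beta> + 2 * card K / (1 - 1 / \<beta>)\<^sup>2 \<le> card (L i)"
  shows "square_free_colorings K L V \<noteq> {}"
proof -
  have "card (square_free_colorings K L V) > 0"
    using \<open>finite V\<close> L
  proof (induction V rule: finite_induct)
    case empty
    \<comment> \<open>For \<open>h \<ge> 1\<close> a progression with \<open>2 * h\<close> terms is
      nonempty, so it never lies in the empty set.\<close>
    have "square_free_colorings K L {} = {\<lambda>_. undefined}"
      by (auto simp: square_free_colorings_def progression_def lessThan_empty_iff)
    then show ?case by simp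
  next
    case (insert v V)
    have "0 < \<beta> * card (square_free_colorings K L V)"
      using insert \<open>\<beta> > 1\<close> by simp
    also have "\<dots> \<le> card (square_free_colorings K L (insert v V))"
      using insert K \<open>\<beta> > 1\<close> by (intro square_free_colorings_insert) auto
    finally show ?case by simp
  qed
  then show ?thesis by auto
qed

text \<open>A repeated block preceded by \<open>u\<close> entries of the list is a square along the
  progression starting at \<open>i + u * d\<close>, and all its terms stay within
  \<open>{1..n}\<close>.\<close>

lemma nonrepetitive_ap_subsequence:
  assumes "c \<in> square_free_colorings K L {1..n}" "d \<in> K" "d > 0" "i \<in> {1..n}"
  shows "nonrepetitive (ap_subsequence c n i d)"
  unfolding nonrepetitive_def contains_repetition_def
proof (intro allI impI notI, elim exE conjE)
  fix h and us ys vs :: "'a list"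
  assume h: "1 \<le> h" "length ys = h" and eq: "ap_subsequence c n i d = us @ ys @ ys @ vs"
  define T u where "T = (n - i) div d" and "u = length us"
  have map_eq: "map (\<lambda>j. c (i + j * d)) [0..<Suc T] = us @ ys @ ys @ vs"
    using eq assms by (simp add: ap_subsequence_eq T_def)
  from arg_cong[OF this, of length] have len: "u + 2 * h \<le> Suc T"
    using h by (simp add: u_def)
  have nth: "c (i + j * d) = (us @ ys @ ys @ vs) ! j" if "j < Suc T" for j
    using arg_cong[OF map_eq, of "\<lambda>xs. xs ! j"] that by (simp del: upt_Suc)
  have "i + j * d \<in> {1..n}" if "j < Suc T" for j
  proof -
    have "j * d \<le> n - i"
      using that \<open>d > 0\<close> by (simp add: T_def less_Suc_eq_le less_eq_div_iff_mult_less_eq)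
    then show ?thesis using assms(4) by auto
  qed
  then have "i + (u + j) * d \<in> {1..n}" if "j < 2 * h" for j
    using that len by simp
  then have "progression d (i + u * d) (2 * h) \<subseteq> {1..n}"
    by (auto simp: progression_def algebra_simps)
  moreover have "c (i + (u + j) * d) = c (i + (u + (h + j)) * d)" if "j < h" for j
  proof -
    have "c (i + (u + j) * d) = ys ! j" "c (i + (u + (h + j)) * d) = ys ! j"
      using that len h by (auto simp: nth nth_append u_def)
    then show ?thesis by simp
  qed
  then have "square_at c d h (i + u * d)"
    by (simp add: square_at_def algebra_simps)
  ultimately show False
    using assms(1,2) h by (auto simp: square_free_colorings_def)
qed

text \<open>With \<beta> = 1 + x the left side is 1 + x + 2k + 4k/x + 2k/x^2, and x = 2
  \<open>sqrt k\<close> balances x against 4k/x. The value is then 2k + 4 \<open>sqrt k\<close> +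
  3/2.\<close>

lemma growth_rate_bound:
  fixes k :: nat
  assumes "k \<ge> 1" and \<beta>: "\<beta> = 1 + 2 * sqrt k"
  shows "\<beta> + 2 * k / (1 - 1 / \<beta>)\<^sup>2 \<le> 2 * real k + 10 * sqrt k"
proof -
  define q where "q = sqrt (real k)"
  have q: "q \<ge> 1" "real k = q\<^sup>2" using assms by (auto simp: q_def)
  have "1 - 1 / \<beta> = 2 * q / (1 + 2 * q)"
    using q unfolding \<beta> q_def[symmetric] by (simp add: field_simps)
  then have "2 * k / (1 - 1 / \<beta>)\<^sup>2 = (1 + 2 * q)\<^sup>2 / 2"
    using q by (simp add: power_divide power_mult_distrib)
  also have "\<dots> = 2 * q\<^sup>2 + 2 * q + 1 / 2"
    by (simp add: power2_eq_square algebra_simps)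
  finally show ?thesis
    using q unfolding \<beta> q_def[symmetric] by simp
qed

theorem theorem2:
  fixes K :: "nat set" and k n :: nat and L :: "nat \<Rightarrow> 'a set"
  assumes "finite K" and "card K = k" and "k \<ge> 1" and "\<forall>d\<in>K. d > 0"
    and "n \<ge> 1"
    and "\<forall>i\<in>{1..n}. infinite (L i) \<or> real (card (L i)) \<ge> 2 * real k + 10 * sqrt (real k)"
  shows "\<exists>s :: nat \<Rightarrow> 'a. (\<forall>i\<in>{1..n}. s i \<in> L i) \<and>
           (\<forall>d\<in>K. \<forall>i\<in>{1..n}. nonrepetitive (ap_subsequence s n i d))"
proof -
  define C where "C = 2 * real k + 10 * sqrt (real k)"
  define \<beta> where "\<beta> = 1 + 2 * sqrt (real k)"
  \<comment> \<open>Infinite lists are thinned to large finite ones, since the counting argument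
    needs finite sets.\<close>
  have "\<exists>F. F \<subseteq> L i \<and> finite F \<and> C \<le> card F" if "i \<in> {1..n}" for i
  proof (cases "finite (L i)")
    case True
    then show ?thesis using assms(6) that by (auto simp: C_def)
  next
    case False
    then obtain F where "F \<subseteq> L i" "finite F" "card F = nat \<lceil>C\<rceil>"
      using infinite_arbitrarily_large by blast
    then show ?thesis using real_nat_ceiling_ge[of C] by auto
  qed
  then obtain F where F: "\<And>i. i \<in> {1..n} \<Longrightarrow> F i \<subseteq> L i \<and> finite (F i) \<and> C \<le> card (F i)"
    by metis
  have "\<beta> > 1" using assms(3) by (simp add: \<beta>_def)
  have "\<beta> + 2 * card K / (1 - 1 / \<beta>)\<^sup>2 \<le> C"
    using growth_rate_bound[OF \<open>k \<ge> 1\<close> \<beta>_def] assms(2) by (simp add: C_def)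
  then have "square_free_colorings K F {1..n} \<noteq> {}"
    using assms(1,4) \<open>\<beta> > 1\<close> F by (intro square_free_colorings_nonempty) (auto intro: order_trans)
  then obtain s where s: "s \<in> square_free_colorings K F {1..n}" by blast
  then have "s i \<in> L i" if "i \<in> {1..n}" for i
    using F[OF that] that by (auto simp: square_free_colorings_def)
  then show ?thesis
    using nonrepetitive_ap_subsequence[OF s] assms(4) by blast
qed

end
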